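(* Let $X\subset\mathbb{R}$. Then $X$ contains a Cantor set if and only if $X$ contains a closed and uncountable subset of $\mathbb{R}$ (that is, there is a set $F\subset X$ which is uncountable and closed in $\mathbb{R}$).
   Context: A set $Y\subset\mathbb{R}$ is nowhere dense if $\operatorname{int}(\overline{Y})=\emptyset$. A set $C\subset\mathbb{R}$ is perfect if $C=C'$, where $C'$ is the set of all accumulation points of $C$ in $\mathbb{R}$. A Cantor set is a nonempty set $C\subset\mathbb{R}$ that is nowhere dense and perfect (this is the definition used; boundedness is not required). *)

theory Defs
  imports "HOL-Analysis.Analysis"
begin

definition nowhere_dense :: "real set \<Rightarrow> bool" where
  "nowhere_dense Y \<longleftrightarrow> interior (closure Y) = {}"

definition perfect :: "real set \<Rightarrow> bool" where
  "perfect C \<longleftrightarrow> C = {x. x islimpt C}"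

(* Boundedness is not required. *)
definition cantor_set :: "real set \<Rightarrow> bool" where
  "cantor_set C \<longleftrightarrow> C \<noteq> {} \<and> nowhere_dense C \<and> perfect C"

end

theory Submission
  imports Defs
begin

text \<open>
  For the forward direction, the Baire category theorem says that a nonempty closed set without isolated
  points cannot be the countable union of its singletons, since each of these is nowhere dense
  in it. A Cantor set is such a set, so it is itself a closed uncountable subset.

  For the converse, the Cantor--Bendixson argument extracts from a closed uncountable set \<open>F\<close>
  the set of its condensation points, which is perfect; it is nonempty because only countably
  many points of \<open>F\<close> fail to be condensation points (\<open>countable_minus_condensation_points\<close>).
  If \<open>F\<close> has empty interior, this perfect kernel is nowhere dense, hence a Cantor set.
  If \<open>F\<close> has an interior point, it contains an interval, and it may first be replaced by a
  closed set of positive Lebesgue measure consisting of irrational points of that interval: this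
  set is uncountable because countable sets are null, and it has empty interior because the
  rationals are dense.
\<close>

definition condensation_points :: "'a::topological_space set \<Rightarrow> 'a set" where
  "condensation_points S = {x. \<forall>U. open U \<longrightarrow> x \<in> U \<longrightarrow> uncountable (S \<inter> U)}"

lemma closed_condensation_points: "closed (condensation_points S)"
  unfolding closed_limpt
proof (intro allI impI)
  fix x assume x: "x islimpt condensation_points S"
  show "x \<in> condensation_points S"
    unfolding condensation_points_def
  proof (intro CollectI allI impI)
    fix U assume "open U" "x \<in> U"
    then obtain y where "y \<in> condensation_points S" "y \<in> U"
      using x by (auto simp: islimpt_def)
    then show "uncountable (S \<inter> U)"
      using \<open>open U\<close> by (auto simp: condensation_points_def)
  qed
qed

lemma condensation_points_subset:
  assumes "closed S"
  shows "condensation_points S \<subseteq> S"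
proof
  fix x assume "x \<in> condensation_points S"
  then have "open (- S) \<Longrightarrow> x \<in> - S \<Longrightarrow> uncountable (S \<inter> - S)"
    unfolding condensation_points_def by blast
  then show "x \<in> S"
    using assms by auto
qed

text \<open>
  A point of \<open>S\<close> that is not a condensation point has an open neighbourhood meeting \<open>S\<close> in a
  countable set. By the Lindelof property countably many of these neighbourhoods suffice.
\<close>

lemma countable_minus_condensation_points:
  fixes S :: "'a::second_countable_topology set"
  shows "countable (S - condensation_points S)"
proof -
  obtain \<U> where \<U>: "\<U> \<subseteq> {U. open U \<and> countable (S \<inter> U)}" "countable \<U>"
    and eq: "\<Union>\<U> = \<Union>{U. open U \<and> countable (S \<inter> U)}"
    by (rule Lindelof[of "{U. open U \<and> countable (S \<inter> U)}"]) auto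
  have "S - condensation_points S \<subseteq> S \<inter> \<Union>\<U>"
    unfolding eq condensation_points_def by blast
  moreover have "S \<inter> \<Union>\<U> = (\<Union>U\<in>\<U>. S \<inter> U)"
    by blast
  moreover have "countable (\<Union>U\<in>\<U>. S \<inter> U)"
    using \<U> by (intro countable_UN) auto
  ultimately show ?thesis
    using countable_subset by metis
qed

text \<open>
  Every neighbourhood of a condensation point meets \<open>S\<close> in an uncountable set, and discarding
  the countably many other points of \<open>S\<close> leaves uncountably many condensation points there.
\<close>

lemma condensation_point_islimpt:
  fixes S :: "'a::second_countable_topology set"
  assumes "x \<in> condensation_points S"
  shows "x islimpt condensation_points S"
  unfolding islimpt_def
proof (intro allI impI)
  fix U assume "x \<in> U" "open U"
  then have "uncountable (S \<inter> U)"
    using assms by (auto simp: condensation_points_def)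
  then have "uncountable (S \<inter> U - (insert x (S - condensation_points S)))"
    by (intro uncountable_minus_countable countable_insert countable_minus_condensation_points)
  then have "S \<inter> U - insert x (S - condensation_points S) \<noteq> {}"
    using countable_empty by metis
  then show "\<exists>y\<in>condensation_points S. y \<in> U \<and> y \<noteq> x"
    by blast
qed

lemma perfect_condensation_points: "perfect (condensation_points S)"
  unfolding perfect_def
  using closed_condensation_points[of S] condensation_point_islimpt[of _ S]
  unfolding closed_limpt by blast

lemma condensation_points_nonempty:
  fixes S :: "'a::second_countable_topology set"
  assumes "uncountable S"
  shows "condensation_points S \<noteq> {}"
proof
  assume "condensation_points S = {}"
  then show False
    using assms countable_minus_condensation_points[of S] by simp
qed

text \<open>
  Removing a non-isolated point from \<open>S\<close> leaves a relatively open dense subset. If \<open>S\<close> were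
  countable, Baire's theorem would apply to all these subsets at once; yet their intersection
  is empty.
\<close>

lemma uncountable_if_no_isolated_points:
  fixes S :: "'a::{real_normed_vector,heine_borel} set"
  assumes "closed S" "S \<noteq> {}" and limpt: "\<And>x. x \<in> S \<Longrightarrow> x islimpt S"
  shows "uncountable S"
proof
  assume "countable S"
  have "S \<subseteq> closure (\<Inter>x\<in>S. S - {x})"
  proof (rule Baire[OF \<open>closed S\<close>])
    show "countable ((\<lambda>x. S - {x}) ` S)"
      using \<open>countable S\<close> by simp
    fix T assume "T \<in> (\<lambda>x. S - {x}) ` S"
    then obtain x where x: "x \<in> S" "T = S - {x}"
      by blast
    have "openin (top_of_set S) T"
      unfolding x(2) by (simp add: openin_delete)
    moreover have "x \<in> closure T"
      using limpt[OF x(1)] x(2) islimpt_punctured[of x S] unfolding closure_def by blast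
    then have "S \<subseteq> closure T"
      using x(2) closure_subset[of T] by auto
    ultimately show "openin (top_of_set S) T \<and> S \<subseteq> closure T" ..
  qed
  moreover have "(\<Inter>x\<in>S. S - {x}) = {}"
    using \<open>S \<noteq> {}\<close> by blast
  ultimately show False
    using \<open>S \<noteq> {}\<close> by simp
qed

text \<open>
  The irrationals in \<open>{a..b}\<close> have full measure, so inner regularity of Lebesgue measure
  yields a closed set of irrationals of positive measure. Having positive measure it is
  uncountable, and containing no rational it has empty interior.
\<close>

lemma closed_uncountable_empty_interior_subset_interval:
  fixes a b :: real
  assumes "a < b"
  obtains T where "closed T" "T \<subseteq> {a..b}" "uncountable T" "interior T = {}"
proof -
  let ?S = "{a..b} - \<rat>"
  have null: "N \<in> null_sets lebesgue" if "countable N" for N :: "real set"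
    using countable_imp_null_set_lborel[OF that] by (rule null_sets_completionI)
  have S: "?S \<in> sets lebesgue"
    using null[OF countable_rat] by (intro sets.Diff) auto
  obtain T where T: "closed T" "T \<subseteq> ?S" "?S - T \<in> lmeasurable"
    "emeasure lebesgue (?S - T) < ennreal (b - a)"
    by (rule sets_lebesgue_inner_closed[OF S, of "b - a"]) (use assms in simp)
  have "uncountable T"
  proof
    assume "countable T"
    then have "T \<union> \<rat> \<in> null_sets lebesgue"
      by (intro null countable_Un countable_rat)
    then have "emeasure lebesgue ({a..b} - (T \<union> \<rat>)) = emeasure lebesgue {a..b}"
      by (intro emeasure_Diff_null_set) auto
    moreover have "{a..b} - (T \<union> \<rat>) = ?S - T"
      by blast
    ultimately show False
      using T(4) assms by simp
  qed
  moreover have "interior T = {}"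
  proof (rule ccontr)
    assume "interior T \<noteq> {}"
    then obtain x e where "e > 0" "ball x e \<subseteq> T"
      by (auto simp: mem_interior)
    moreover obtain q where "q \<in> \<rat>" "x < q" "q < x + e"
      using Rats_dense_in_real[of x "x + e"] \<open>e > 0\<close> by auto
    ultimately have "q \<in> T"
      by (auto simp: dist_real_def subset_iff)
    then show False
      using T(2) \<open>q \<in> \<rat>\<close> by blast
  qed
  ultimately show thesis
    using T that by blast
qed

lemma closed_uncountable_empty_interior_subset:
  fixes F :: "real set"
  assumes "closed F" "uncountable F"
  obtains T where "closed T" "T \<subseteq> F" "uncountable T" "interior T = {}"
proof (cases "interior F = {}")
  case True
  then show ?thesis
    using assms that by blast
next
  case False
  then obtain x e where "e > 0" "cball x e \<subseteq> F"
    by (auto simp: mem_interior_cball)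
  then have "{x - e..x + e} \<subseteq> F" "x - e < x + e"
    by (auto simp: cball_eq_atLeastAtMost)
  then obtain T where "closed T" "T \<subseteq> {x - e..x + e}" "uncountable T" "interior T = {}"
    by (elim closed_uncountable_empty_interior_subset_interval)
  then show ?thesis
    using \<open>{x - e..x + e} \<subseteq> F\<close> that by blast
qed

theorem theorem4p1:
  fixes X :: "real set"
  shows "(\<exists>C. C \<subseteq> X \<and> cantor_set C) \<longleftrightarrow> (\<exists>F. F \<subseteq> X \<and> closed F \<and> uncountable F)"
proof
  assume "\<exists>C. C \<subseteq> X \<and> cantor_set C"
  then obtain C where C: "C \<subseteq> X" "C \<noteq> {}" and eq: "C = {x. x islimpt C}"
    unfolding cantor_set_def perfect_def by blast
  have "closed C"
    using eq unfolding closed_limpt by blast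
  moreover have "uncountable C"
    using \<open>closed C\<close> \<open>C \<noteq> {}\<close> by (rule uncountable_if_no_isolated_points) (use eq in blast)
  ultimately show "\<exists>F. F \<subseteq> X \<and> closed F \<and> uncountable F"
    using C by blast
next
  assume "\<exists>F. F \<subseteq> X \<and> closed F \<and> uncountable F"
  then obtain F where F: "F \<subseteq> X" "closed F" "uncountable F"
    by blast
  obtain T where T: "closed T" "T \<subseteq> F" "uncountable T" "interior T = {}"
    using F(2,3) by (rule closed_uncountable_empty_interior_subset)
  let ?C = "condensation_points T"
  have "?C \<subseteq> T"
    using T(1) by (rule condensation_points_subset)
  then have "nowhere_dense ?C"
    using interior_mono[of ?C T] T(4)
    by (simp add: nowhere_dense_def closure_closed closed_condensation_points)
  then have "cantor_set ?C"
    using T(3) by (simp add: cantor_set_def perfect_condensation_points condensation_points_nonempty)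
  moreover have "?C \<subseteq> X"
    using \<open>?C \<subseteq> T\<close> T(2) F(1) by blast
  ultimately show "\<exists>C. C \<subseteq> X \<and> cantor_set C"
    by blast
qed

end
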